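(* For every finite non-commutative ring $R$, the non-commuting graph $\Gamma_R$ is neither a star graph nor a lollipop graph.
   Context: Rings are associative and not assumed to have a unity. For a ring $R$, $Z(R)=\{x\in R : xr=rx \text{ for all } r\in R\}$ is its center. The non-commuting graph $\Gamma_R$ of a finite ring $R$ is the simple undirected graph with vertex set $R\setminus Z(R)$ in which two distinct vertices $a,b$ are adjacent if and only if $ab\neq ba$. A star graph is a tree on $n$ vertices in which one vertex has degree $n-1$ and the others have degree $1$. A lollipop graph is a graph consisting of a complete graph and a path graph (each with at least one vertex), connected with a bridge, i.e. an edge joining a vertex of the complete graph to an end vertex of the path. *)

theory Defs
  imports "Graph_Theory.Graph_Theory"
begin

text \<open>
  The type class \<open>ring\<close> is that of associative rings without the requirement of a unity.
  Following \<open>Graph_Theory\<close>, a simple undirected graph is a finite, loop-free symmetric digraph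
  without parallel arcs (\<open>pair_graph\<close>): an edge between \<open>u\<close> and \<open>v\<close> is represented by the two
  arcs \<open>(u, v)\<close> and \<open>(v, u)\<close>, so that the degree of a vertex is its out-degree.
\<close>

definition ring_center :: "'a::ring set" where
  "ring_center = {x. \<forall>r. x * r = r * x}"

definition non_commuting_graph :: "'a::ring pair_pre_digraph" where
  "non_commuting_graph =
     \<lparr> pverts = UNIV - ring_center,
       parcs = {(a, b). a \<in> UNIV - ring_center \<and> b \<in> UNIV - ring_center \<and>
                        a \<noteq> b \<and> a * b \<noteq> b * a} \<rparr>"

lemma pair_graph_non_commuting_graph:
  "pair_graph (non_commuting_graph :: 'a::{finite, ring} pair_pre_digraph)"
  by unfold_locales
    (auto simp: non_commuting_graph_def symmetric_def intro!: symI)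

text \<open>
  The library's \<open>forest\<close> and \<open>tree\<close> are not usable for symmetric digraphs, in which an edge
  traversed back and forth is already a \<open>cycle\<close>. The cycles of an undirected simple graph are
  those of length at least 3.
\<close>

definition undirected_tree :: "'a pair_pre_digraph \<Rightarrow> bool" where
  "undirected_tree G \<longleftrightarrow>
     pair_graph G \<and> connected (with_proj G) \<and>
     \<not> (\<exists>p. pre_digraph.cycle (with_proj G) p \<and> length p \<ge> 3)"

definition star_graph :: "'a pair_pre_digraph \<Rightarrow> bool" where
  "star_graph G \<longleftrightarrow>
     undirected_tree G \<and>
     (\<exists>c \<in> pverts G.
        out_degree (with_proj G) c = card (pverts G) - 1 \<and>
        (\<forall>v \<in> pverts G - {c}. out_degree (with_proj G) v = 1))"

text \<open>\<open>path_graph_along vs P\<close>: \<open>P\<close> is the path graph visiting its vertices in the order \<open>vs\<close>;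
  its end vertices are \<open>hd vs\<close> and \<open>last vs\<close>.\<close>

definition path_graph_along :: "'a list \<Rightarrow> 'a pair_pre_digraph \<Rightarrow> bool" where
  "path_graph_along vs P \<longleftrightarrow>
     vs \<noteq> [] \<and> distinct vs \<and> pverts P = set vs \<and>
     parcs P = set (vwalk_arcs vs) \<union> (set (vwalk_arcs vs))\<inverse>"

definition lollipop_graph :: "'a pair_pre_digraph \<Rightarrow> bool" where
  "lollipop_graph G \<longleftrightarrow>
     (\<exists>K P m vs a b.
        complete_digraph m (with_proj K) \<and> m \<ge> 1 \<and>
        path_graph_along vs P \<and>
        pverts K \<inter> pverts P = {} \<and>
        a \<in> pverts K \<and> b \<in> {hd vs, last vs} \<and>
        pverts G = pverts K \<union> pverts P \<and>
        parcs G = parcs K \<union> parcs P \<union> {(a, b), (b, a)})"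

end

theory Submission
  imports Defs
begin

text \<open>
  Both families of graphs contain a vertex with at most one neighbour, as soon as they have an edge:
  any vertex of a star other than its centre, and the end of the path of a lollipop that lies away
  from the bridge. A non-commuting graph contains no such vertex. Indeed, if \<open>y\<close> does not commute
  with \<open>x\<close>, then neither does \<open>x + y\<close>, because \<open>x\<close> commutes with itself; and \<open>x + y \<noteq> y\<close> because
  \<open>0\<close> is central. So every vertex \<open>x\<close> has at least two neighbours
  (\<open>non_commuting_graph_two_neighbours\<close>), which rules out both families.
\<close>

lemma non_commuting_graph_arc_iff:
  fixes x y :: "'a::ring"
  shows "(x, y) \<in> parcs non_commuting_graph \<longleftrightarrow> x * y \<noteq> y * x"
  unfolding non_commuting_graph_def ring_center_def by auto metis

lemma non_commuting_graph_two_neighbours: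
  fixes x :: "'a::ring"
  assumes "x \<in> pverts non_commuting_graph"
  obtains y z where "y \<noteq> z" "(x, y) \<in> parcs non_commuting_graph"
    "(x, z) \<in> parcs non_commuting_graph"
proof -
  from assms obtain y where y: "x * y \<noteq> y * x"
    by (auto simp: non_commuting_graph_def ring_center_def)
  then have "x \<noteq> 0" by auto
  with y show thesis
    by (intro that[of y "x + y"]) (auto simp: non_commuting_graph_arc_iff algebra_simps)
qed

lemma non_commuting_graph_out_degree:
  fixes x :: "'a::{finite, ring}"
  assumes "x \<in> pverts non_commuting_graph"
  shows "2 \<le> out_degree (with_proj non_commuting_graph) x"
proof -
  obtain y z where yz: "y \<noteq> z" "(x, y) \<in> parcs non_commuting_graph"
    "(x, z) \<in> parcs non_commuting_graph"
    using non_commuting_graph_two_neighbours[OF assms] .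
  then have "{(x, y), (x, z)} \<subseteq> out_arcs (with_proj non_commuting_graph) x"
    by (auto simp: out_arcs_def)
  then have "card {(x, y), (x, z)} \<le> out_degree (with_proj non_commuting_graph) x"
    unfolding out_degree_def by (intro card_mono) auto
  with yz(1) show ?thesis by simp
qed

lemma path_graph_along_rev:
  assumes "path_graph_along vs P"
  shows "path_graph_along (rev vs) P"
  using assms unfolding path_graph_along_def set_vwalk_arcs_rev by auto

text \<open>
  The end of the path that is not on the bridge has only its path neighbour left; if the path
  is a single vertex, the bridge provides its only neighbour.
\<close>

lemma lollipop_graph_pendant_vertex:
  assumes "lollipop_graph G"
  obtains x w where "x \<in> pverts G" "\<And>u. (x, u) \<in> parcs G \<Longrightarrow> u = w"
proof -
  from assms obtain K P m vs a b where
    K: "complete_digraph m (with_proj K)" and vs: "path_graph_along vs P" and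
    disjoint: "pverts K \<inter> pverts P = {}" and a: "a \<in> pverts K" and b: "b \<in> {hd vs, last vs}" and
    verts: "pverts G = pverts K \<union> pverts P" and
    arcs: "parcs G = parcs K \<union> parcs P \<union> {(a, b), (b, a)}"
    unfolding lollipop_graph_def by metis
  \<comment> \<open>Traverse the path towards the bridge.\<close>
  obtain us where us: "path_graph_along us P" and b_last: "b = last us"
    using b vs path_graph_along_rev[OF vs] by (metis insert_iff empty_iff last_rev)
  from us have us_props: "us \<noteq> []" "distinct us" "pverts P = set us"
    "parcs P = set (vwalk_arcs us) \<union> (set (vwalk_arcs us))\<inverse>"
    by (simp_all add: path_graph_along_def)
  have K_arcs: "(u, v) \<notin> parcs K" if "u \<in> set us" for u v
    using that K disjoint us_props(3) by (auto simp: complete_digraph_pair_def)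
  have a_us: "a \<notin> set us" using a disjoint us_props(3) by auto
  consider x where "us = [x]" | x w ws where "us = x # w # ws"
    using us_props(1) by (metis neq_Nil_conv)
  then show thesis
  proof cases
    case (1 x)
    show thesis
      by (rule that[of x a]) (use 1 verts arcs us_props K_arcs a_us b_last in auto)
  next
    case (2 x w ws)
    have "x \<noteq> b" using us_props(2) b_last 2 by auto
    show thesis
    proof (rule that[of x w])
      show "x \<in> pverts G" using 2 verts us_props by simp
      fix u assume "(x, u) \<in> parcs G"
      then have "(x, u) \<in> parcs P" using arcs K_arcs 2 a_us \<open>x \<noteq> b\<close> by auto
      then show "u = w" using us_props 2 by (auto dest: arcs_in_vwalk_arcs)
    qed
  qed
qed

theorem theorem2p2:
  assumes "\<exists>x y :: 'a::{finite, ring}. x * y \<noteq> y * x"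
  shows "\<not> star_graph (non_commuting_graph :: 'a pair_pre_digraph) \<and>
         \<not> lollipop_graph (non_commuting_graph :: 'a pair_pre_digraph)"
proof
  show "\<not> star_graph (non_commuting_graph :: 'a pair_pre_digraph)"
  proof
    assume "star_graph (non_commuting_graph :: 'a pair_pre_digraph)"
    then obtain c :: 'a where
      c: "\<And>v. v \<in> pverts non_commuting_graph - {c} \<Longrightarrow>
            out_degree (with_proj non_commuting_graph) v = 1"
      unfolding star_graph_def by blast
    from assms obtain x y :: 'a where xy: "x * y \<noteq> y * x" by blast
    then have "x \<in> pverts non_commuting_graph" "y \<in> pverts non_commuting_graph" "x \<noteq> y"
      by (auto simp: non_commuting_graph_def ring_center_def) metis
    then obtain v where v: "v \<in> pverts non_commuting_graph" "v \<noteq> c" by metis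
    then have "out_degree (with_proj non_commuting_graph) v = 1" using c by simp
    with non_commuting_graph_out_degree[OF v(1)] show False by simp
  qed
  show "\<not> lollipop_graph (non_commuting_graph :: 'a pair_pre_digraph)"
    by (metis lollipop_graph_pendant_vertex non_commuting_graph_two_neighbours)
qed

end
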